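(* Let $H=H(x,p)$ be a smooth real-valued function of two real variables, and let $\delta_n$ be an arbitrary positive function of the time step $h$ and of $x_n,p_n,x_{n+1},p_{n+1}$, etc. (it may depend on the step $n$). Suppose that $(x_n,p_n)$ and $(x_{n+1},p_{n+1})$ satisfy the numerical scheme $$\frac{x_{n+1}-x_n}{\delta_n}=\frac{H(x_{n+1},p_{n+1})+H(x_n,p_{n+1})-H(x_{n+1},p_n)-H(x_n,p_n)}{2(p_{n+1}-p_n)},$$ $$\frac{p_{n+1}-p_n}{\delta_n}=\frac{H(x_n,p_{n+1})+H(x_n,p_n)-H(x_{n+1},p_{n+1})-H(x_{n+1},p_n)}{2(x_{n+1}-x_n)}.$$ Then the scheme preserves the energy integral exactly: $$H(x_{n+1},p_{n+1})=H(x_n,p_n).$$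
   Context: The scheme is a family of one-step (implicit) discrete gradient methods for the one-dimensional Hamiltonian system $\dot x=H_p$, $\dot p=-H_x$ (subscripts denote partial derivatives), whose energy integral is $H(x,p)$. The number $h>0$ is the time step, and $(x_n,p_n)$ denotes the numerical solution after $n$ steps. "Exactly" refers to exact arithmetic. Convention: when a denominator $p_{n+1}-p_n$ or $x_{n+1}-x_n$ vanishes, the corresponding quotient on the right-hand side is understood as its limiting value, i.e. the first right-hand side becomes $\tfrac12\left(H_p(x_{n+1},p_n)+H_p(x_n,p_n)\right)$ if $p_{n+1}=p_n$, and the second becomes $-\tfrac12\left(H_x(x_n,p_{n+1})+H_x(x_n,p_n)\right)$ if $x_{n+1}=x_n$. *)

theory Defs
  imports "HOL-Analysis.Analysis"
begin

definition partial_x :: "(real \<Rightarrow> real \<Rightarrow> real) \<Rightarrow> real \<Rightarrow> real \<Rightarrow> real" where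
  "partial_x H x p = deriv (\<lambda>s. H s p) x"

definition partial_p :: "(real \<Rightarrow> real \<Rightarrow> real) \<Rightarrow> real \<Rightarrow> real \<Rightarrow> real" where
  "partial_p H x p = deriv (\<lambda>s. H x s) p"

text \<open>\<open>C_k k H\<close>: all iterated partial derivatives of \<open>H\<close> of order at most \<open>k\<close> exist on the whole
  plane and are jointly continuous.\<close>

primrec C_k :: "nat \<Rightarrow> (real \<Rightarrow> real \<Rightarrow> real) \<Rightarrow> bool" where
  "C_k 0 H \<longleftrightarrow> continuous_on UNIV (\<lambda>(x, p). H x p)"
| "C_k (Suc k) H \<longleftrightarrow>
     continuous_on UNIV (\<lambda>(x, p). H x p) \<and>
     (\<forall>x p. (\<lambda>s. H s p) differentiable (at x)) \<and>
     (\<forall>x p. (\<lambda>s. H x s) differentiable (at p)) \<and>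
     C_k k (partial_x H) \<and> C_k k (partial_p H)"

definition smooth :: "(real \<Rightarrow> real \<Rightarrow> real) \<Rightarrow> bool" where
  "smooth H \<longleftrightarrow> (\<forall>k. C_k k H)"

text \<open>The two discrete gradient quotients for a step from \<open>(x, p)\<close> to \<open>(x', p')\<close>. A quotient
  whose denominator vanishes stands for its limiting value.\<close>

definition rhs_x :: "(real \<Rightarrow> real \<Rightarrow> real) \<Rightarrow> real \<Rightarrow> real \<Rightarrow> real \<Rightarrow> real \<Rightarrow> real" where
  "rhs_x H x p x' p' =
     (if p' = p then (partial_p H x' p + partial_p H x p) / 2
      else (H x' p' + H x p' - H x' p - H x p) / (2 * (p' - p)))"

definition rhs_p :: "(real \<Rightarrow> real \<Rightarrow> real) \<Rightarrow> real \<Rightarrow> real \<Rightarrow> real \<Rightarrow> real \<Rightarrow> real" where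
  "rhs_p H x p x' p' =
     (if x' = x then - (partial_x H x p' + partial_x H x p) / 2
      else (H x p' + H x p - H x' p' - H x' p) / (2 * (x' - x)))"

definition scheme_step ::
  "(real \<Rightarrow> real \<Rightarrow> real) \<Rightarrow> real \<Rightarrow> real \<Rightarrow> real \<Rightarrow> real \<Rightarrow> real \<Rightarrow> bool" where
  "scheme_step H d x p x' p' \<longleftrightarrow>
     (x' - x) / d = rhs_x H x p x' p' \<and>
     (p' - p) / d = rhs_p H x p x' p'"

end

theory Submission
  imports Defs
begin

text \<open>The pair \<open>(- rhs_p, rhs_x)\<close> is a discrete gradient of \<open>H\<close>: its inner product with the
  increment of \<open>(x, p)\<close> is exactly the increment of \<open>H\<close>. The scheme makes the
  increment a multiple of this gradient rotated by a right angle, so the increment is orthogonal to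
  the gradient and \<open>H\<close> does not change. This is the discrete form of
  \<open>dH/dt = H_x H_p + H_p (- H_x) = 0\<close>.\<close>

text \<open>The quotients average the difference of \<open>H\<close> in one variable over the old and new value of the
  other. Once the denominators are cleared, the sum adds the increments along the two coordinate
  paths from \<open>(x, p)\<close> to \<open>(x', p')\<close> and halves them; both paths give \<open>H x' p' - H x p\<close>. A quotient
  whose denominator vanishes is multiplied by that zero, and the difference it stands for is zero as
  well.\<close>

lemma discrete_chain_rule:
  "H x' p' - H x p = (x' - x) * (- rhs_p H x p x' p') + (p' - p) * rhs_x H x p x' p'"
proof -
  have "2 * ((p' - p) * rhs_x H x p x' p') = H x' p' + H x p' - H x' p - H x p"
    by (simp add: rhs_x_def field_simps)
  moreover have "2 * ((x' - x) * rhs_p H x p x' p') = H x p' + H x p - H x' p' - H x' p"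
    by (simp add: rhs_p_def field_simps)
  ultimately show ?thesis
    by (simp add: algebra_simps)
qed

lemma scheme_step_preserves_energy:
  assumes "scheme_step H d x p x' p'"
  shows "H x' p' = H x p"
proof -
  have "H x' p' - H x p = (x' - x) * (- ((p' - p) / d)) + (p' - p) * ((x' - x) / d)"
    using assms discrete_chain_rule[of H x' p' x p] by (simp only: scheme_step_def)
  then show ?thesis
    by (simp add: mult.commute)
qed

theorem theorem2p1:
  fixes H :: "real \<Rightarrow> real \<Rightarrow> real"
    and \<delta> :: "nat \<Rightarrow> real \<Rightarrow> (nat \<Rightarrow> real) \<Rightarrow> (nat \<Rightarrow> real) \<Rightarrow> real"
    and x p :: "nat \<Rightarrow> real"
    and h :: real
    and n :: nat
  assumes "smooth H"
    and "h > 0"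
    and "\<And>m k y q. k > 0 \<Longrightarrow> \<delta> m k y q > 0"
    and "scheme_step H (\<delta> n h x p) (x n) (p n) (x (Suc n)) (p (Suc n))"
  shows "H (x (Suc n)) (p (Suc n)) = H (x n) (p n)"
  using assms(4) by (rule scheme_step_preserves_energy)

end
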